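(* Let $G$ be a group, let $X$ be an infinite transitive $G$-space and let $A\subseteq X$. Then: (i) $A$ is large (i.e. there exists a finite subset $K\subseteq G$ with $X=KA$) if and only if $A_p\neq\varnothing$ for each $p\in X^*$; (ii) $A$ is thick (i.e. for every finite subset $K\subseteq G$ there exists $a\in A$ with $Ka\subseteq A$) if and only if there exists $p\in X^*$ such that $A_p=Gp$. Here, for $p\in\beta X$, $Gp=\{gp: g\in G\}$ and $A_p=\{gp: g\in G,\ A\in gp\}$.
   Context: A $G$-space is a set $X$ with an action $G\times X\to X$, $(g,x)\mapsto gx$; it is transitive if for all $x,y\in X$ there is $g\in G$ with $gx=y$. For $K\subseteq G$ and $A\subseteq X$, $KA=\{ka: k\in K, a\in A\}$ and $Ka=\{ka:k\in K\}$. $\beta X$ is the set of all ultrafilters on $X$ (the Stone–Čech compactification of discrete $X$, principal ultrafilters identified with points of $X$), and $X^*=\beta X\setminus X$ is the set of free (non-principal) ultrafilters on $X$. For $g\in G$ and $p\in\beta X$, $gp=\{gP: P\in p\}$ where $gP=\{gx:x\in P\}$. *)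

theory Defs
  imports "HOL-Algebra.Group_Action"
begin

text \<open>
  A \<open>G\<close>-space is a library group action: \<open>\<phi> g x\<close> is \<open>gx\<close>, and the underlying set is a carrier
  set \<open>X\<close>. Ultrafilters on \<open>X\<close> are therefore families of subsets of \<open>X\<close> rather than elements of
  the type \<open>'a filter\<close>, whose members are subsets of a whole type.
\<close>

definition ultrafilter_on :: "'x set \<Rightarrow> 'x set set \<Rightarrow> bool" where
  "ultrafilter_on X p \<longleftrightarrow>
     p \<subseteq> Pow X \<and> X \<in> p \<and> {} \<notin> p \<and>
     (\<forall>P\<in>p. \<forall>Q\<in>p. P \<inter> Q \<in> p) \<and>
     (\<forall>P\<in>p. \<forall>Q. P \<subseteq> Q \<and> Q \<subseteq> X \<longrightarrow> Q \<in> p) \<and>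
     (\<forall>P. P \<subseteq> X \<longrightarrow> P \<in> p \<or> X - P \<in> p)"

definition stone_cech :: "'x set \<Rightarrow> 'x set set set" where
  "stone_cech X = {p. ultrafilter_on X p}"

definition principal_ultrafilter :: "'x set \<Rightarrow> 'x \<Rightarrow> 'x set set" where
  "principal_ultrafilter X x = {P. P \<subseteq> X \<and> x \<in> P}"

definition free_ultrafilters :: "'x set \<Rightarrow> 'x set set set" where
  "free_ultrafilters X = stone_cech X - principal_ultrafilter X ` X"

definition ultra_act :: "('g \<Rightarrow> 'x \<Rightarrow> 'x) \<Rightarrow> 'g \<Rightarrow> 'x set set \<Rightarrow> 'x set set" where
  "ultra_act \<phi> g p = {\<phi> g ` P | P. P \<in> p}"

definition set_act :: "('g \<Rightarrow> 'x \<Rightarrow> 'x) \<Rightarrow> 'g set \<Rightarrow> 'x set \<Rightarrow> 'x set" where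
  "set_act \<phi> K A = {\<phi> k a | k a. k \<in> K \<and> a \<in> A}"

definition large :: "('g, 'm) monoid_scheme \<Rightarrow> 'x set \<Rightarrow> ('g \<Rightarrow> 'x \<Rightarrow> 'x) \<Rightarrow> 'x set \<Rightarrow> bool" where
  "large G X \<phi> A \<longleftrightarrow> (\<exists>K. finite K \<and> K \<subseteq> carrier G \<and> X = set_act \<phi> K A)"

definition thick :: "('g, 'm) monoid_scheme \<Rightarrow> ('g \<Rightarrow> 'x \<Rightarrow> 'x) \<Rightarrow> 'x set \<Rightarrow> bool" where
  "thick G \<phi> A \<longleftrightarrow>
     (\<forall>K. finite K \<and> K \<subseteq> carrier G \<longrightarrow> (\<exists>a\<in>A. {\<phi> k a | k. k \<in> K} \<subseteq> A))"

text \<open>The set \<open>A\<^sub>p\<close>. The full orbit \<open>Gp\<close> is \<open>orbit G (ultra_act \<phi>) p\<close>.\<close>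

definition ultra_companion ::
    "('g, 'm) monoid_scheme \<Rightarrow> ('g \<Rightarrow> 'x \<Rightarrow> 'x) \<Rightarrow> 'x set \<Rightarrow> 'x set set \<Rightarrow> 'x set set set" where
  "ultra_companion G \<phi> A p = {ultra_act \<phi> g p | g. g \<in> carrier G \<and> A \<in> ultra_act \<phi> g p}"

end

theory Submission
  imports Defs
begin

text \<open>
  Writing \<open>g\<^sup>-\<^sup>1A\<close> for the preimage of \<open>A\<close> under \<open>g\<close>, one has \<open>A \<in> gp\<close> iff \<open>g\<^sup>-\<^sup>1A \<in> p\<close>, and \<open>A\<close> is
  large iff finitely many preimages \<open>g\<^sup>-\<^sup>1A\<close> cover \<open>X\<close>. In that case every ultrafilter contains one
  of them. If \<open>A\<close> is not large, then finitely many preimages even leave infinitely many points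
  uncovered, because transitivity would allow a finite remainder to be covered by further
  preimages; hence some free ultrafilter contains all complements of preimages. Part (ii) is part (i)
  for the complement, since \<open>A\<close> is thick iff \<open>X - A\<close> is not large.
\<close>

text \<open>Zorn's lemma yields a maximal family above \<open>F\<close> all of whose finite
  intersections are infinite within \<open>X\<close>. Maximality makes it an ultrafilter. Asking for
  infinite rather than nonempty intersections keeps singletons out, so it is free.\<close>

lemma free_ultrafilter_extends:
  assumes "F \<subseteq> Pow X" and "\<And>S. finite S \<Longrightarrow> S \<subseteq> F \<Longrightarrow> infinite (X \<inter> \<Inter>S)"
  shows "\<exists>p\<in>free_ultrafilters X. F \<subseteq> p"
proof -
  define \<A> where
    "\<A> = {M. F \<subseteq> M \<and> M \<subseteq> Pow X \<and> (\<forall>S. finite S \<longrightarrow> S \<subseteq> M \<longrightarrow> infinite (X \<inter> \<Inter>S))}"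
  have "F \<in> \<A>" using assms by (auto simp: \<A>_def)
  have chain: "\<Union>\<C> \<in> \<A>" if "\<C> \<noteq> {}" and ch: "subset.chain \<A> \<C>" for \<C>
  proof -
    have sub: "\<C> \<subseteq> \<A>" using ch by (simp add: subset.chain_def)
    have "infinite (X \<inter> \<Inter>S)" if S: "finite S" "S \<subseteq> \<Union>\<C>" for S
    proof -
      \<comment> \<open>A finite subset of the union of a nonempty chain lies in a single member, so
        a condition on finite subfamilies passes to the union.\<close>
      obtain M where "M \<in> \<C>" "S \<subseteq> M"
        using finite_subset_Union_chain[OF S \<open>\<C> \<noteq> {}\<close> ch] .
      then show ?thesis using sub \<open>finite S\<close> by (auto simp: \<A>_def)
    qed
    moreover have "F \<subseteq> \<Union>\<C>" using \<open>\<C> \<noteq> {}\<close> sub by (force simp: \<A>_def)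
    moreover have "\<Union>\<C> \<subseteq> Pow X" using sub by (force simp: \<A>_def)
    ultimately show ?thesis by (simp add: \<A>_def)
  qed
  obtain M where "M \<in> \<A>" and max: "\<And>N. N \<in> \<A> \<Longrightarrow> M \<subseteq> N \<Longrightarrow> N = M"
    using subset_Zorn_nonempty[OF _ chain] \<open>F \<in> \<A>\<close> by blast
  then have "F \<subseteq> M" and M_sub: "M \<subseteq> Pow X"
    and inf: "\<And>S. finite S \<Longrightarrow> S \<subseteq> M \<Longrightarrow> infinite (X \<inter> \<Inter>S)"
    by (auto simp: \<A>_def)
  \<comment> \<open>Maximality in usable form: a set that has infinite trace on every finite
    intersection from \<open>M\<close> can be adjoined within \<open>\<A>\<close>, hence is already
    in \<open>M\<close>. The positive ultrafilter axioms all come from this.\<close>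
  have memI: "Q \<in> M"
    if "Q \<subseteq> X" and Q: "\<And>S. finite S \<Longrightarrow> S \<subseteq> M \<Longrightarrow> infinite (X \<inter> \<Inter>S \<inter> Q)" for Q
  proof -
    have "infinite (X \<inter> \<Inter>S)" if "finite S" "S \<subseteq> insert Q M" for S
    proof -
      \<comment> \<open>Whether or not \<open>Q\<close> occurs in \<open>S\<close>, this set is
        contained in \<open>X \<inter> \<Inter>S\<close>.\<close>
      have "infinite (X \<inter> \<Inter>(S - {Q}) \<inter> Q)" using Q that by blast
      then show ?thesis by (rule contrapos_nn) (erule finite_subset[rotated], blast)
    qed
    then have "insert Q M \<in> \<A>" using \<open>F \<subseteq> M\<close> M_sub \<open>Q \<subseteq> X\<close> by (auto simp: \<A>_def)
    then show ?thesis using max[of "insert Q M"] by blast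
  qed
  have "X \<in> M" using inf by (intro memI) (auto simp: Int_ac)
  moreover have "{} \<notin> M" using inf[of "{{}}"] by auto
  moreover have "P \<inter> Q \<in> M" if "P \<in> M" "Q \<in> M" for P Q
  proof (rule memI)
    show "P \<inter> Q \<subseteq> X" using that M_sub by blast
    show "infinite (X \<inter> \<Inter>S \<inter> (P \<inter> Q))" if "finite S" "S \<subseteq> M" for S
      using inf[of "insert P (insert Q S)"] that \<open>P \<in> M\<close> \<open>Q \<in> M\<close> by (simp add: Int_ac)
  qed
  moreover have "Q \<in> M" if "P \<in> M" "P \<subseteq> Q" "Q \<subseteq> X" for P Q
  proof (rule memI[OF \<open>Q \<subseteq> X\<close>])
    show "infinite (X \<inter> \<Inter>S \<inter> Q)" if "finite S" "S \<subseteq> M" for S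
    proof -
      have "infinite (X \<inter> \<Inter>(insert P S))" using inf that \<open>P \<in> M\<close> by blast
      then show ?thesis
        by (rule contrapos_nn) (erule finite_subset[rotated], use \<open>P \<subseteq> Q\<close> in blast)
    qed
  qed
  moreover have "P \<in> M \<or> X - P \<in> M" if "P \<subseteq> X" for P
  proof (rule ccontr)
    assume "\<not> ?thesis"
    then obtain S T where S: "finite S" "S \<subseteq> M" "finite (X \<inter> \<Inter>S \<inter> P)"
      and T: "finite T" "T \<subseteq> M" "finite (X \<inter> \<Inter>T \<inter> (X - P))"
      using memI[OF \<open>P \<subseteq> X\<close>] memI[OF Diff_subset] by metis
    \<comment> \<open>The part of this intersection inside \<open>P\<close> is finite because of
      \<open>S\<close>, the part outside because of \<open>T\<close>.\<close>
    have "finite (X \<inter> \<Inter>(S \<union> T))"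
      by (rule finite_subset[OF _ finite_UnI[OF S(3) T(3)]]) blast
    then show False using inf[of "S \<union> T"] S T by blast
  qed
  ultimately have "M \<in> stone_cech X"
    using M_sub unfolding stone_cech_def ultrafilter_on_def by blast
  moreover have "M \<noteq> principal_ultrafilter X x" if "x \<in> X" for x
  proof
    assume "M = principal_ultrafilter X x"
    then have "{x} \<in> M" using that by (simp add: principal_ultrafilter_def)
    then show False using inf[of "{{x}}"] by auto
  qed
  ultimately show ?thesis using \<open>F \<subseteq> M\<close> by (auto simp: free_ultrafilters_def)
qed

lemma ultrafilter_on_Diff_iff:
  assumes "ultrafilter_on X p" and "P \<subseteq> X"
  shows "X - P \<in> p \<longleftrightarrow> P \<notin> p"
proof
  assume "X - P \<in> p"
  moreover have "(X - P) \<inter> P = {}" by blast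
  ultimately show "P \<notin> p" using assms(1) unfolding ultrafilter_on_def by metis
next
  assume "P \<notin> p"
  then show "X - P \<in> p" using assms unfolding ultrafilter_on_def by blast
qed

text \<open>Ultrafilters are prime: if \<open>B j\<close> is not in \<open>p\<close>, its complement
  is, and cutting the union down to that complement leaves a subset of the remaining union.\<close>

lemma ultrafilter_on_finite_Un:
  assumes "ultrafilter_on X p" and "finite K" and "\<And>k. k \<in> K \<Longrightarrow> B k \<subseteq> X"
    and "(\<Union>k\<in>K. B k) \<in> p"
  shows "\<exists>k\<in>K. B k \<in> p"
  using assms(2-)
proof (induction K rule: finite_induct)
  case empty
  then show ?case using assms(1) by (simp add: ultrafilter_on_def)
next
  case (insert j K)
  define U where "U = (\<Union>k\<in>K. B k)"
  have "B j \<union> U \<in> p" using insert.prems by (simp add: U_def)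
  have "U \<subseteq> X" using insert.prems by (auto simp: U_def)
  show ?case
  proof (cases "B j \<in> p")
    case False
    then have "X - B j \<in> p" using ultrafilter_on_Diff_iff[OF assms(1)] insert.prems by simp
    then have "(B j \<union> U) \<inter> (X - B j) \<in> p"
      using \<open>B j \<union> U \<in> p\<close> assms(1) by (simp add: ultrafilter_on_def)
    moreover have "(B j \<union> U) \<inter> (X - B j) \<subseteq> U" by blast
    ultimately have "U \<in> p"
      using \<open>U \<subseteq> X\<close> assms(1) unfolding ultrafilter_on_def by meson
    then show ?thesis using insert unfolding U_def by simp
  qed simp
qed

context group_action
begin

text \<open>Each \<open>\<phi> g\<close> permutes \<open>E\<close>: injectivity recovers
  \<open>P\<close> from its image, surjectivity makes \<open>A\<close> the image of its preimage.
  Questions about all translates of \<open>p\<close> thus become questions about \<open>p\<close>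
  alone.\<close>

lemma mem_ultra_act_iff:
  assumes "p \<subseteq> Pow E" and "g \<in> carrier G" and "A \<subseteq> E"
  shows "A \<in> ultra_act \<phi> g p \<longleftrightarrow> {x \<in> E. \<phi> g x \<in> A} \<in> p"
proof
  assume "A \<in> ultra_act \<phi> g p"
  then obtain P where "P \<in> p" "A = \<phi> g ` P" by (auto simp: ultra_act_def)
  moreover from this have "{x \<in> E. \<phi> g x \<in> \<phi> g ` P} = P"
    using assms(1) inj_onD[OF inj_prop[OF assms(2)]] by blast
  ultimately show "{x \<in> E. \<phi> g x \<in> A} \<in> p" by simp
next
  assume "{x \<in> E. \<phi> g x \<in> A} \<in> p"
  moreover have "A = \<phi> g ` {x \<in> E. \<phi> g x \<in> A}"
  proof
    show "A \<subseteq> \<phi> g ` {x \<in> E. \<phi> g x \<in> A}"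
    proof
      fix a assume "a \<in> A"
      then obtain x where "x \<in> E" "\<phi> g x = a" using assms bij_prop1 by blast
      then show "a \<in> \<phi> g ` {x \<in> E. \<phi> g x \<in> A}" using \<open>a \<in> A\<close> by blast
    qed
  qed blast
  ultimately show "A \<in> ultra_act \<phi> g p" unfolding ultra_act_def by blast
qed

text \<open>Since \<open>x = \<phi> k a\<close> amounts to \<open>\<phi> (inv k) x = a\<close>,
  replacing \<open>K\<close> by its inverses turns a cover by translates into a cover by preimages,
  and back.\<close>

lemma large_iff:
  assumes "A \<subseteq> E"
  shows "large G E \<phi> A \<longleftrightarrow>
    (\<exists>K. finite K \<and> K \<subseteq> carrier G \<and> (\<forall>x\<in>E. \<exists>k\<in>K. \<phi> k x \<in> A))"
proof -
  interpret group G using group_hom group_hom.axioms(1) by auto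
  show ?thesis
  proof
    assume "large G E \<phi> A"
    then obtain K where K: "finite K" "K \<subseteq> carrier G" "E = set_act \<phi> K A"
      by (auto simp: large_def)
    have "\<exists>k \<in> m_inv G ` K. \<phi> k x \<in> A" if x: "x \<in> E" for x
    proof -
      obtain k a where "k \<in> K" "a \<in> A" "x = \<phi> k a"
        using x K(3) unfolding set_act_def by blast
      then have "\<phi> (inv k) x = a" using orbit_sym_aux K(2) assms by blast
      then show ?thesis using \<open>k \<in> K\<close> \<open>a \<in> A\<close> by blast
    qed
    moreover have "m_inv G ` K \<subseteq> carrier G" using K(2) by auto
    ultimately show "\<exists>K. finite K \<and> K \<subseteq> carrier G \<and> (\<forall>x\<in>E. \<exists>k\<in>K. \<phi> k x \<in> A)"
      using K(1) by blast
  next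
    assume "\<exists>K. finite K \<and> K \<subseteq> carrier G \<and> (\<forall>x\<in>E. \<exists>k\<in>K. \<phi> k x \<in> A)"
    then obtain K where K: "finite K" "K \<subseteq> carrier G" "\<forall>x\<in>E. \<exists>k\<in>K. \<phi> k x \<in> A"
      by blast
    have "E = set_act \<phi> (m_inv G ` K) A"
    proof
      show "E \<subseteq> set_act \<phi> (m_inv G ` K) A"
      proof
        fix x assume "x \<in> E"
        then obtain k where "k \<in> K" "\<phi> k x \<in> A" using K(3) by blast
        moreover from this have "x = \<phi> (inv k) (\<phi> k x)"
          using orbit_sym_aux[of k x] K(2) \<open>x \<in> E\<close> by auto
        ultimately show "x \<in> set_act \<phi> (m_inv G ` K) A" unfolding set_act_def by blast
      qed
      show "set_act \<phi> (m_inv G ` K) A \<subseteq> E"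
      proof
        fix y assume "y \<in> set_act \<phi> (m_inv G ` K) A"
        then obtain k a where "k \<in> K" "a \<in> A" "y = \<phi> (inv k) a"
          by (auto simp: set_act_def)
        then show "y \<in> E" using element_image[of "inv k" a y] K(2) assms by auto
      qed
    qed
    moreover have "m_inv G ` K \<subseteq> carrier G" using K(2) by auto
    ultimately show "large G E \<phi> A" using K(1) unfolding large_def by blast
  qed
qed

lemma thick_iff_not_large_Diff:
  assumes "A \<subseteq> E"
  shows "thick G \<phi> A \<longleftrightarrow> \<not> large G E \<phi> (E - A)"
proof -
  interpret group G using group_hom group_hom.axioms(1) by auto
  have mem: "\<phi> k x \<in> E" if "k \<in> carrier G" "x \<in> E" for k x
    using that element_image by blast
  have one: "\<phi> \<one> x = x" if "x \<in> E" for x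
    using that id_eq_one by (metis restrict_apply')
  have "thick G \<phi> A \<longleftrightarrow>
      (\<forall>K. finite K \<and> K \<subseteq> carrier G \<longrightarrow> (\<exists>x\<in>E. \<forall>k\<in>K. \<phi> k x \<in> A))"
    (is "_ \<longleftrightarrow> ?R")
  proof
    assume "thick G \<phi> A"
    show ?R
    proof (intro allI impI)
      fix K assume "finite K \<and> K \<subseteq> carrier G"
      then obtain a where "a \<in> A" "{\<phi> k a |k. k \<in> K} \<subseteq> A"
        using \<open>thick G \<phi> A\<close> unfolding thick_def by meson
      then show "\<exists>x\<in>E. \<forall>k\<in>K. \<phi> k x \<in> A" using assms by blast
    qed
  next
    assume R: ?R
    show "thick G \<phi> A"
      unfolding thick_def
    proof (intro allI impI)
      fix K assume "finite K \<and> K \<subseteq> carrier G"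
      \<comment> \<open>Thickness wants the base point itself in \<open>A\<close>; adjoining the
        identity to \<open>K\<close> forces this.\<close>
      then have "finite (insert \<one> K) \<and> insert \<one> K \<subseteq> carrier G" by simp
      then obtain x where "x \<in> E" "\<forall>k\<in>insert \<one> K. \<phi> k x \<in> A" using R by blast
      then show "\<exists>a\<in>A. {\<phi> k a |k. k \<in> K} \<subseteq> A" using one by auto
    qed
  qed
  also have "\<dots> \<longleftrightarrow> \<not> large G E \<phi> (E - A)"
  proof -
    have "(\<exists>x\<in>E. \<forall>k\<in>K. \<phi> k x \<in> A) \<longleftrightarrow> \<not> (\<forall>x\<in>E. \<exists>k\<in>K. \<phi> k x \<in> E - A)"
      if "K \<subseteq> carrier G" for K
      using mem that by blast
    then show ?thesis unfolding large_iff[OF Diff_subset] by meson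
  qed
  finally show ?thesis .
qed

text \<open>The preimages of \<open>A\<close> and \<open>E - A\<close> under \<open>g\<close> are
  complementary, so \<open>p\<close> contains exactly one of them, and each translate of
  \<open>p\<close> contains exactly one of \<open>A\<close> and \<open>E - A\<close>.\<close>

lemma ultra_companion_eq_orbit_iff:
  assumes "ultrafilter_on E p" and "A \<subseteq> E"
  shows "ultra_companion G \<phi> A p = orbit G (ultra_act \<phi>) p \<longleftrightarrow>
    ultra_companion G \<phi> (E - A) p = {}"
proof -
  have p: "p \<subseteq> Pow E" using assms(1) by (simp add: ultrafilter_on_def)
  have "E - A \<in> ultra_act \<phi> g p \<longleftrightarrow> A \<notin> ultra_act \<phi> g p" if g: "g \<in> carrier G" for g
  proof -
    have "{x \<in> E. \<phi> g x \<in> E - A} = E - {x \<in> E. \<phi> g x \<in> A}"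
      using element_image[OF g] by blast
    then show ?thesis
      using mem_ultra_act_iff[OF p g Diff_subset, of A] mem_ultra_act_iff[OF p g assms(2)]
        ultrafilter_on_Diff_iff[OF assms(1), of "{x \<in> E. \<phi> g x \<in> A}"] by simp
  qed
  then have "ultra_companion G \<phi> (E - A) p = {} \<longleftrightarrow> (\<forall>g\<in>carrier G. A \<in> ultra_act \<phi> g p)"
    unfolding ultra_companion_def by blast
  \<comment> \<open>Different \<open>g\<close> may give the same translate, but whether
    \<open>A\<close> belongs to it depends only on the translate.\<close>
  also have "\<dots> \<longleftrightarrow> ultra_companion G \<phi> A p = orbit G (ultra_act \<phi>) p"
    unfolding ultra_companion_def orbit_def by blast
  finally show ?thesis by simp
qed

end

lemma (in transitive_action) infinite_uncovered:
  assumes "infinite E" and "A \<subseteq> E" and "\<not> large G E \<phi> A"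
    and "finite K" and "K \<subseteq> carrier G"
  shows "infinite {x \<in> E. \<forall>k\<in>K. \<phi> k x \<notin> A}"
\<comment> \<open>The main argument moves points into \<open>A\<close> and so needs an element of
  \<open>A\<close>. For empty \<open>A\<close> all of \<open>E\<close> is uncovered.\<close>
proof (cases "A = {}")
  case True
  then show ?thesis using \<open>infinite E\<close> by simp
next
  case False
  then obtain a where "a \<in> A" by blast
  show ?thesis
  proof
    assume fin: "finite {x \<in> E. \<forall>k\<in>K. \<phi> k x \<notin> A}" (is "finite ?F")
    have "\<forall>x\<in>E. \<exists>g\<in>carrier G. \<phi> g x = a"
      using unique_orbit \<open>a \<in> A\<close> assms(2) by blast
    \<comment> \<open>By transitivity \<open>h x\<close> carries \<open>x\<close> to the fixed point
      \<open>a\<close> of \<open>A\<close>. If only finitely many points were uncovered, adding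
      their \<open>h x\<close> to \<open>K\<close> would witness that \<open>A\<close> is
      large.\<close>
    then obtain h where h: "\<And>x. x \<in> E \<Longrightarrow> h x \<in> carrier G \<and> \<phi> (h x) x = a" by metis
    have "\<forall>x\<in>E. \<exists>k\<in>K \<union> h ` ?F. \<phi> k x \<in> A" using h \<open>a \<in> A\<close> by blast
    moreover have "finite (K \<union> h ` ?F)" "K \<union> h ` ?F \<subseteq> carrier G"
      using fin h assms(4,5) by auto
    ultimately have "large G E \<phi> A" using large_iff[OF assms(2)] by blast
    then show False using assms(3) by blast
  qed
qed

lemma (in transitive_action) large_iff_ultra_companion:
  assumes "infinite E" and "A \<subseteq> E"
  shows "large G E \<phi> A \<longleftrightarrow> (\<forall>p\<in>free_ultrafilters E. ultra_companion G \<phi> A p \<noteq> {})"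
proof
  assume "large G E \<phi> A"
  then obtain K where K: "finite K" "K \<subseteq> carrier G" "\<forall>x\<in>E. \<exists>k\<in>K. \<phi> k x \<in> A"
    using large_iff[OF assms(2)] by blast
  show "\<forall>p\<in>free_ultrafilters E. ultra_companion G \<phi> A p \<noteq> {}"
  proof
    fix p assume "p \<in> free_ultrafilters E"
    then have p: "ultrafilter_on E p" by (simp add: free_ultrafilters_def stone_cech_def)
    \<comment> \<open>\<open>E\<close> belongs to \<open>p\<close>, so primeness puts one of these
      preimages in \<open>p\<close>.\<close>
    have "(\<Union>k\<in>K. {x \<in> E. \<phi> k x \<in> A}) = E" using K(3) by blast
    then obtain k where "k \<in> K" "{x \<in> E. \<phi> k x \<in> A} \<in> p"
      using ultrafilter_on_finite_Un[OF p K(1), of "\<lambda>k. {x \<in> E. \<phi> k x \<in> A}"] p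
      by (auto simp: ultrafilter_on_def)
    moreover have "p \<subseteq> Pow E" using p by (simp add: ultrafilter_on_def)
    ultimately have "k \<in> carrier G" "A \<in> ultra_act \<phi> k p"
      using mem_ultra_act_iff K(2) assms(2) by blast+
    then show "ultra_companion G \<phi> A p \<noteq> {}" unfolding ultra_companion_def by blast
  qed
next
  assume comp: "\<forall>p\<in>free_ultrafilters E. ultra_companion G \<phi> A p \<noteq> {}"
  show "large G E \<phi> A"
  proof (rule ccontr)
    assume not_large: "\<not> large G E \<phi> A"
    define B where "B g = {x \<in> E. \<phi> g x \<in> A}" for g
    \<comment> \<open>A finite intersection of these complements is the set of points left uncovered
      by finitely many preimages, infinite by \<open>infinite_uncovered\<close>. The resulting
      \<open>p\<close> contains no preimage of \<open>A\<close>, so its companion set is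
      empty.\<close>
    have "\<exists>p\<in>free_ultrafilters E. (\<lambda>g. E - B g) ` carrier G \<subseteq> p"
    proof (rule free_ultrafilter_extends)
      fix S assume "finite S" "S \<subseteq> (\<lambda>g. E - B g) ` carrier G"
      then obtain K where K: "K \<subseteq> carrier G" "finite K" "S = (\<lambda>g. E - B g) ` K"
        by (meson finite_subset_image)
      then have "E \<inter> \<Inter>S = {x \<in> E. \<forall>k\<in>K. \<phi> k x \<notin> A}" by (auto simp: B_def)
      then show "infinite (E \<inter> \<Inter>S)"
        using infinite_uncovered[OF assms not_large K(2,1)] by simp
    qed blast
    then obtain p where "p \<in> free_ultrafilters E"
      and sub: "\<And>g. g \<in> carrier G \<Longrightarrow> E - B g \<in> p" by blast
    then have p: "ultrafilter_on E p" by (simp add: free_ultrafilters_def stone_cech_def)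
    have "A \<notin> ultra_act \<phi> g p" if g: "g \<in> carrier G" for g
    proof -
      have "B g \<notin> p"
        using ultrafilter_on_Diff_iff[OF p, of "B g"] sub[OF g] by (auto simp: B_def)
      then show ?thesis
        using mem_ultra_act_iff[OF _ g assms(2)] p by (auto simp: B_def ultrafilter_on_def)
    qed
    then have "ultra_companion G \<phi> A p = {}" by (auto simp: ultra_companion_def)
    then show False using comp \<open>p \<in> free_ultrafilters E\<close> by blast
  qed
qed

theorem theorem4p1:
  fixes G :: "('g, 'm) monoid_scheme" and X :: "'x set"
    and \<phi> :: "'g \<Rightarrow> 'x \<Rightarrow> 'x" and A :: "'x set"
  assumes "group G"
    and "transitive_action G X \<phi>"
    and "infinite X"
    and "A \<subseteq> X"
  shows "(large G X \<phi> A \<longleftrightarrow> (\<forall>p\<in>free_ultrafilters X. ultra_companion G \<phi> A p \<noteq> {})) \<and>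
         (thick G \<phi> A \<longleftrightarrow>
            (\<exists>p\<in>free_ultrafilters X. ultra_companion G \<phi> A p = orbit G (ultra_act \<phi>) p))"
proof -
  interpret transitive_action G X \<phi> by fact
  have "thick G \<phi> A \<longleftrightarrow> (\<exists>p\<in>free_ultrafilters X. ultra_companion G \<phi> (X - A) p = {})"
    using thick_iff_not_large_Diff[OF assms(4)]
      large_iff_ultra_companion[OF assms(3), of "X - A"] by blast
  also have "\<dots> \<longleftrightarrow>
      (\<exists>p\<in>free_ultrafilters X. ultra_companion G \<phi> A p = orbit G (ultra_act \<phi>) p)"
    using ultra_companion_eq_orbit_iff[OF _ assms(4)]
    by (auto simp: free_ultrafilters_def stone_cech_def)
  finally show ?thesis using large_iff_ultra_companion[OF assms(3,4)] by blast
qed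

end
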